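(* Let $f:\mathbb{R}^2\to \mathbb{R}^2$ be an orientation-preserving homeomorphism. If $f$ has a topologically chain recurrent point, then $f$ has a fixed point.
   Context: Let $\Delta = \{(p,p): p \in \mathbb{R}^2\}$ be the diagonal in the product $\mathbb{R}^2\times\mathbb{R}^2$. For any neighborhood $N$ of $\Delta$ in $\mathbb{R}^2\times\mathbb{R}^2$, an $N$-chain (for $f$) is a sequence $(p_0, p_1, \ldots, p_n)$ of points in $\mathbb{R}^2$, with $n\ge 1$, such that $(f(p_{i-1}), p_i) \in N$ for $i=1,\ldots,n$. It is an $N$-chain from $p_0$ to $p_n$. A point $p\in\mathbb{R}^2$ is topologically chain recurrent (for $f$) if for every neighborhood $N$ of $\Delta$ there is an $N$-chain from $p$ to itself. *)

theory Defs
  imports "HOL-Complex_Analysis.Complex_Analysis"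
begin

definition diagonal :: "('a \<times> 'a) set" where
  "diagonal = {(p, p) | p. True}"

text \<open>Neighborhoods are not required to be open.\<close>

definition diagonal_nbhd :: "('a::topological_space \<times> 'a) set \<Rightarrow> bool" where
  "diagonal_nbhd N \<longleftrightarrow> (\<exists>U. open U \<and> diagonal \<subseteq> U \<and> U \<subseteq> N)"

text \<open>The sequence \<open>(p 0, \<dots>, p n)\<close> is given by the values of \<open>p\<close> at indices up to \<open>n\<close>;
  its values beyond \<open>n\<close> are irrelevant.\<close>

definition nbhd_chain :: "('a \<times> 'a) set \<Rightarrow> ('a \<Rightarrow> 'a) \<Rightarrow> nat \<Rightarrow> (nat \<Rightarrow> 'a) \<Rightarrow> bool" where
  "nbhd_chain N f n p \<longleftrightarrow> n \<ge> 1 \<and> (\<forall>i\<in>{1..n}. (f (p (i - 1)), p i) \<in> N)"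

definition nbhd_chain_from_to ::
    "('a \<times> 'a) set \<Rightarrow> ('a \<Rightarrow> 'a) \<Rightarrow> nat \<Rightarrow> (nat \<Rightarrow> 'a) \<Rightarrow> 'a \<Rightarrow> 'a \<Rightarrow> bool" where
  "nbhd_chain_from_to N f n p a b \<longleftrightarrow> nbhd_chain N f n p \<and> p 0 = a \<and> p n = b"

definition topologically_chain_recurrent ::
    "('a::topological_space \<Rightarrow> 'a) \<Rightarrow> 'a \<Rightarrow> bool" where
  "topologically_chain_recurrent f a \<longleftrightarrow>
     (\<forall>N. diagonal_nbhd N \<longrightarrow> (\<exists>n p. nbhd_chain_from_to N f n p a a))"

definition plane_to_complex :: "real ^ 2 \<Rightarrow> complex" where
  "plane_to_complex x = Complex (x $ 1) (x $ 2)"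

definition plane_winding_number :: "(real \<Rightarrow> real ^ 2) \<Rightarrow> real ^ 2 \<Rightarrow> complex" where
  "plane_winding_number \<gamma> z = winding_number (plane_to_complex \<circ> \<gamma>) (plane_to_complex z)"

text \<open>The winding number about \<open>z\<close> identifies the first homology group of the plane minus \<open>z\<close>,
  equivalently the local homology group of the plane at \<open>z\<close> in degree 2, with the integers, and so
  expresses the standard local orientation at \<open>z\<close>. A homeomorphism \<open>f\<close> preserves orientation iff
  at every point \<open>z\<close> it carries the local orientation at \<open>z\<close> to the one at \<open>f z\<close>, i.e. its induced
  map between these groups is \<open>+1\<close>. An orientation-reversing homeomorphism instead changes the
  sign of every winding number. The predicate is meant for homeomorphisms only.\<close>

definition orientation_preserving :: "(real ^ 2 \<Rightarrow> real ^ 2) \<Rightarrow> bool" where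
  "orientation_preserving f \<longleftrightarrow>
     (\<forall>z \<gamma>. path \<gamma> \<and> pathfinish \<gamma> = pathstart \<gamma> \<and> z \<notin> path_image \<gamma> \<longrightarrow>
        plane_winding_number (f \<circ> \<gamma>) (f z) = plane_winding_number \<gamma> z)"

end

theory Submission
  imports Defs
begin

text \<open>
  Suppose that \<open>f\<close> has no fixed point. The proof has two halves: a fixed-point-free homeomorphism
  that preserves orientation has no periodic point, and a chain recurrent point would allow a small
  modification of \<open>f\<close> that has one. The plane is identified with the complex numbers.

  \<^bold>\<open>No periodic points\<close> (lemma \<open>no_periodic_point\<close>). The angle by which \<open>f\<close> turns the vector from
  \<open>x\<close> to \<open>y\<close> is defined modulo \<open>2 * pi\<close>. Because \<open>f\<close> preserves winding numbers, it lifts to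
  a continuous real function of pairs of distinct points, and this lift is symmetric in \<open>x\<close> and
  \<open>y\<close> (lemma \<open>rotation_function\<close>). As the plane is simply connected, the direction of the
  displacement from \<open>x\<close> to \<open>f x\<close> has a continuous angle \<open>\<Theta>\<close> too, and the two lifts can be
  normalised so that \<open>\<Theta> (f x) - \<Theta> x\<close> is the turning of the pair \<open>(x, f x)\<close>.

  Take a translation arc, an arc from a point \<open>y\<close> to \<open>f y\<close> that meets its image only in end
  points, and let \<open>\<gamma>\<close> be the curve formed by the arc and its successive images. If \<open>\<gamma>\<close> ever
  returned to itself, at a first time \<open>T\<close> with \<open>\<gamma> T = \<gamma> s\<close>, then \<open>\<gamma> u - \<gamma> t\<close> would have no
  zero on the set of pairs \<open>(t, u)\<close> with \<open>t < u < T\<close> or \<open>s < t < u = T\<close>. This set is convex, so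
  the angle of \<open>\<gamma> u - \<gamma> t\<close> lifts there. Comparing this lift at the four pairs \<open>(s, s + 1)\<close>, \<open>(s, T - 1)\<close>,
  \<open>(s + 1, T)\<close> and \<open>(T - 1, T)\<close> by means of the turning function gives a contradiction; this is
  lemma \<open>no_self_meeting_trajectory\<close>. Translation arcs pass through every point
  (lemma \<open>translation_arc_exists\<close>), and through a periodic point the curve does return.

  \<^bold>\<open>From chains to periodic points\<close> (lemma \<open>no_closed_chain\<close>). A radial stretch of the plane makes
  all displacements of \<open>f\<close> at least one (lemma \<open>displacement_at_least_one_coordinates\<close>), so that
  modifying \<open>f\<close> by less than one, as measured after the stretch, creates no fixed point. In a
  closed chain of minimal length with jumps shorter than a fixed bound, the segments spanned by the
  jumps are pairwise disjoint, since two crossing jumps could be reconnected to a shorter closed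
  chain. Disjoint segments have disjoint neighbourhoods in which the jumps are realised by a
  homeomorphism near the identity, and its composition with \<open>f\<close> has a periodic orbit.
\<close>

section \<open>The turning of pairs of points\<close>

lemma logarithms_differ_by_constant:
  fixes g h :: "'a::topological_space \<Rightarrow> complex"
  assumes "connected S" "continuous_on S g" "continuous_on S h"
    and eq: "\<And>x. x \<in> S \<Longrightarrow> exp (g x) = exp (h x)"
  obtains c where "\<And>x. x \<in> S \<Longrightarrow> g x = h x + c"
proof -
  have "(\<lambda>x. g x - h x) constant_on S"
  proof (rule continuous_discrete_range_constant[OF \<open>connected S\<close>])
    show "continuous_on S (\<lambda>x. g x - h x)"
      by (intro continuous_intros assms)
    fix x assume x: "x \<in> S"
    have "2 * pi \<le> norm ((g y - h y) - (g x - h x))"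
      if y: "y \<in> S" and ne: "g y - h y \<noteq> g x - h x" for y
    proof -
      have "exp (g y - h y) = exp (g x - h x)"
        using eq x y by (simp add: exp_diff)
      then obtain n :: int where n: "g y - h y = g x - h x + (of_int (2 * n) * pi) * \<i>"
        by (metis exp_eq)
      with ne have "n \<noteq> 0" by auto
      then have "1 \<le> \<bar>real_of_int n\<bar>" by linarith
      then have "2 * pi * 1 \<le> 2 * pi * \<bar>real_of_int n\<bar>"
        by (intro mult_left_mono) auto
      moreover have "(g y - h y) - (g x - h x) = of_real (2 * pi * n) * \<i>"
        using n by (simp add: algebra_simps)
      moreover have "norm (of_real (2 * pi * n) * \<i>) = 2 * pi * \<bar>real_of_int n\<bar>"
        by (simp add: norm_mult abs_mult)
      ultimately show ?thesis by simp
    qed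
    then show "\<exists>e>0. \<forall>y. y \<in> S \<and> g y - h y \<noteq> g x - h x \<longrightarrow> e \<le> norm ((g y - h y) - (g x - h x))"
      by (intro exI[of _ "2 * pi"]) auto
  qed
  then obtain c where "\<And>x. x \<in> S \<Longrightarrow> g x - h x = c"
    unfolding constant_on_def by blast
  then have "\<And>x. x \<in> S \<Longrightarrow> g x = h x + c"
    by (metis add.commute diff_add_cancel)
  then show thesis by (rule that)
qed

text \<open>
  Here \<open>Im (E (x, w))\<close> is the angle by which \<open>f\<close> turns the vector \<open>exp w\<close> attached at \<open>x\<close>.
  The pairs of distinct points are parametrised by \<open>(x, x + exp w)\<close>, because the parameter space
  is contractible while the space of pairs is not. A full turn of \<open>w\<close> changes \<open>E\<close> by a constant,
  which is determined by any one small circle, so orientation needs to be inspected at a single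
  point \<open>a\<close> only. Symmetry holds since exchanging the two points also changes \<open>E\<close> by a constant,
  and doing so twice amounts to a full turn.
\<close>

lemma rotation_function:
  fixes f :: "complex \<Rightarrow> complex"
  assumes cont: "continuous_on UNIV f" and inj: "inj f"
    and r: "0 < r" and wind: "winding_number (f \<circ> circlepath a r) (f a) = 1"
  obtains E :: "complex \<times> complex \<Rightarrow> complex" where
    "continuous_on UNIV E"
    "\<And>x w. f (x + exp w) - f x = exp (w + E (x, w))"
    "\<And>x v w. exp v = exp w \<Longrightarrow> E (x, v) = E (x, w)"
    "\<And>x w. E (x + exp w, w + pi * \<i>) = E (x, w)"
proof -
  define Q where "Q = (\<lambda>(x, w). (f (x + exp w) - f x) / exp w)"
  have contf: "continuous_on S (\<lambda>x. f (g x))" if "continuous_on S g" for S and g :: "complex \<times> complex \<Rightarrow> complex"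
    by (rule continuous_on_compose2[OF cont that]) auto
  have "continuous_on UNIV Q"
    unfolding Q_def case_prod_unfold by (intro continuous_intros contf) auto
  moreover have "Q z \<noteq> 0" for z
    by (cases z) (auto simp: Q_def dest: injD[OF inj])
  ultimately obtain E where E: "continuous_on UNIV E" and expE: "\<And>z. Q z = exp (E z)"
    using continuous_logarithm_on_contractible[of UNIV Q] convex_imp_contractible[of UNIV]
    by (metis UNIV_I convex_UNIV)
  have eqE: "f (x + exp w) - f x = exp (w + E (x, w))" for x w
    using expE[of "(x, w)"] by (simp add: Q_def exp_add field_simps)
  have contE: "continuous_on S (\<lambda>z. E (g z))" if "continuous_on S g"
    for S :: "'b::topological_space set" and g
    by (rule continuous_on_compose2[OF E that]) auto
  have shift: "exp (v + 2 * pi * \<i>) = exp v" for v :: complex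
    by (simp add: exp_add)
  obtain c where c: "\<And>z. E (fst z, snd z + 2 * pi * \<i>) = E z + c"
  proof (rule logarithms_differ_by_constant[of UNIV "\<lambda>z. E (fst z, snd z + 2 * pi * \<i>)" E])
    show "exp (E (fst z, snd z + 2 * pi * \<i>)) = exp (E z)" for z
      unfolding expE[symmetric] Q_def case_prod_unfold by (simp add: exp_add)
    show "continuous_on UNIV (\<lambda>z. E (fst z, snd z + 2 * pi * \<i>))"
      by (intro contE continuous_intros)
  qed (use E in auto)
  \<comment> \<open>Along the circle around \<open>a\<close>, a logarithm of the image loop gains \<open>2 * pi * \<i> + c\<close>, and
    this total is \<open>2 * pi * \<i>\<close> times the winding number.\<close>
  have "c = 0"
  proof -
    define p where "p = f \<circ> circlepath a r"
    define w where "w = (\<lambda>t::real. complex_of_real (ln r) + 2 * pi * \<i> * t)"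
    have circ: "circlepath a r t = a + exp (w t)" for t
      using r by (simp add: w_def circlepath exp_add exp_of_real algebra_simps)
    have p: "p t = f a + exp (w t + E (a, w t))" for t
      using eqE[of a "w t"] unfolding p_def o_def circ by (metis add.commute diff_add_cancel)
    have "path p"
      unfolding p_def by (intro path_continuous_image continuous_on_subset[OF cont]) auto
    moreover have "f a \<notin> path_image p"
      unfolding path_image_def using p by auto
    ultimately obtain q where q: "path q"
      "pathfinish q - pathstart q = 2 * of_real pi * \<i> * winding_number p (f a)"
      "\<And>t. t \<in> {0..1} \<Longrightarrow> p t = f a + exp (q t)"
      using winding_number_as_continuous_log by blast
    obtain d where d: "\<And>t. t \<in> {0..1} \<Longrightarrow> q t = (w t + E (a, w t)) + d"
    proof (rule logarithms_differ_by_constant[of "{0..1}" q "\<lambda>t. w t + E (a, w t)"])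
      show "continuous_on {0..1} q" using q(1) by (simp add: path_def)
      show "continuous_on {0..1} (\<lambda>t. w t + E (a, w t))"
        unfolding w_def by (intro continuous_intros contE)
      show "exp (q t) = exp (w t + E (a, w t))" if "t \<in> {0..1}" for t
        using q(3)[OF that] p[of t] by simp
    qed auto
    have "pathfinish q - pathstart q = (w 1 + E (a, w 1)) - (w 0 + E (a, w 0))"
      using d[of 0] d[of 1] by (simp add: pathfinish_def pathstart_def)
    also have "w 1 = w 0 + 2 * pi * \<i>" by (simp add: w_def)
    also have "E (a, w 0 + 2 * pi * \<i>) = E (a, w 0) + c" using c[of "(a, w 0)"] by simp
    finally show ?thesis using q(2) wind by (simp add: p_def)
  qed
  with c have per1: "E (x, v + 2 * pi * \<i>) = E (x, v)" for x v
    by (metis add.right_neutral fst_conv snd_conv)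
  have pern: "E (x, v + of_nat n * (2 * pi * \<i>)) = E (x, v)" for x v n
  proof (induction n)
    case (Suc n)
    have "v + of_nat (Suc n) * (2 * pi * \<i>) = (v + of_nat n * (2 * pi * \<i>)) + 2 * pi * \<i>"
      by (simp add: algebra_simps)
    then show ?case using per1 Suc by metis
  qed simp
  have per: "E (x, v) = E (x, w)" if vw: "exp v = exp w" for x v w
  proof -
    obtain n :: int where n: "v = w + (of_int (2 * n) * pi) * \<i>" using vw by (metis exp_eq)
    show ?thesis
    proof (cases "n \<ge> 0")
      case True
      then have "v = w + of_nat (nat n) * (2 * pi * \<i>)" using n by (simp add: algebra_simps)
      then show ?thesis using pern by metis
    next
      case False
      then have "w = v + of_nat (nat (- n)) * (2 * pi * \<i>)" using n by (simp add: algebra_simps)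
      then show ?thesis using pern by metis
    qed
  qed
  have anti: "exp (v + pi * \<i>) = - exp v" for v :: complex
    by (simp add: exp_add)
  obtain d where d: "\<And>z. E (fst z + exp (snd z), snd z + pi * \<i>) = E z + d"
  proof (rule logarithms_differ_by_constant[of UNIV "\<lambda>z. E (fst z + exp (snd z), snd z + pi * \<i>)" E])
    show "exp (E (fst z + exp (snd z), snd z + pi * \<i>)) = exp (E z)" for z
      unfolding expE[symmetric] Q_def case_prod_unfold
      by (simp add: anti divide_simps)
    show "continuous_on UNIV (\<lambda>z. E (fst z + exp (snd z), snd z + pi * \<i>))"
      by (intro contE continuous_intros)
  qed (use E in auto)
  have "E (0, 0 + pi * \<i> + pi * \<i>) = E (0, 0) + d + d"
    using d[of "(0, 0)"] d[of "(1, pi * \<i>)"] by simp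
  moreover have "E (0, 0 + pi * \<i> + pi * \<i>) = E (0, 0)"
    using per1[of 0 0] by (simp add: algebra_simps)
  ultimately have "d = 0" by (simp add: add.assoc)
  with d have "E (x + exp w, w + pi * \<i>) = E (x, w)" for x w
    by (metis add.right_neutral fst_conv snd_conv)
  then show thesis using that E eqE per by blast
qed

text \<open>
  The vector from \<open>f x\<close> to \<open>f (f x)\<close> joins the images of \<open>x\<close> and \<open>f x\<close>, so the two sides of the
  last equation are logarithms of the same function and differ by a constant. Adding that constant to
  \<open>E\<close> removes the difference and keeps the other properties.
\<close>

lemma displacement_logarithm:
  fixes f :: "complex \<Rightarrow> complex"
  assumes cont: "continuous_on UNIV f" and inj: "inj f" and fpf: "\<And>x. f x \<noteq> x"
    and r: "0 < r" and wind: "winding_number (f \<circ> circlepath a r) (f a) = 1"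
  obtains E :: "complex \<times> complex \<Rightarrow> complex" and \<Theta> :: "complex \<Rightarrow> complex" where
    "continuous_on UNIV E" "continuous_on UNIV \<Theta>"
    "\<And>x w. f (x + exp w) - f x = exp (w + E (x, w))"
    "\<And>x v w. exp v = exp w \<Longrightarrow> E (x, v) = E (x, w)"
    "\<And>x w. E (x + exp w, w + pi * \<i>) = E (x, w)"
    "\<And>x. f x - x = exp (\<Theta> x)"
    "\<And>x. \<Theta> (f x) = \<Theta> x + E (x, \<Theta> x)"
proof -
  obtain E :: "complex \<times> complex \<Rightarrow> complex" where E: "continuous_on UNIV E"
    "\<And>x w. f (x + exp w) - f x = exp (w + E (x, w))"
    "\<And>x v w. exp v = exp w \<Longrightarrow> E (x, v) = E (x, w)"
    "\<And>x w. E (x + exp w, w + pi * \<i>) = E (x, w)"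
    using rotation_function[OF cont inj r wind] by blast
  have "continuous_on UNIV (\<lambda>x. f x - x)" by (intro continuous_intros cont)
  then obtain \<Theta> where \<Theta>: "continuous_on UNIV \<Theta>" and exp\<Theta>: "\<And>x. f x - x = exp (\<Theta> x)"
    using continuous_logarithm_on_contractible[of UNIV "\<lambda>x. f x - x"] convex_imp_contractible[of UNIV] fpf
    by (metis UNIV_I convex_UNIV eq_iff_diff_eq_0)
  obtain c where c: "\<And>x. \<Theta> (f x) = \<Theta> x + E (x, \<Theta> x) + c"
  proof (rule logarithms_differ_by_constant[of UNIV "\<lambda>x. \<Theta> (f x)" "\<lambda>x. \<Theta> x + E (x, \<Theta> x)"])
    show "continuous_on UNIV (\<lambda>x. \<Theta> (f x))"
      by (rule continuous_on_compose2[OF \<Theta> cont]) auto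
    show "continuous_on UNIV (\<lambda>x. \<Theta> x + E (x, \<Theta> x))"
      by (intro continuous_intros \<Theta> continuous_on_compose2[OF E(1)]) auto
    show "exp (\<Theta> (f x)) = exp (\<Theta> x + E (x, \<Theta> x))" for x
      using E(2)[of x "\<Theta> x"] exp\<Theta>[of x] exp\<Theta>[of "f x"] 
      by (metis add.commute diff_add_cancel)
  qed auto
  have "exp c = 1"
  proof -
    have "exp (\<Theta> (f 0)) = exp (\<Theta> 0 + E (0, \<Theta> 0))"
      using E(2)[of 0 "\<Theta> 0"] exp\<Theta>[of 0] exp\<Theta>[of "f 0"] 
      by (metis add.commute diff_add_cancel)
    then show ?thesis using c[of 0] by (simp add: exp_add)
  qed
  show thesis
  proof (rule that[of "\<lambda>z. E z + c" \<Theta>])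
    show "continuous_on UNIV (\<lambda>z. E z + c)" by (intro continuous_intros E)
    show "f (x + exp w) - f x = exp (w + (E (x, w) + c))" for x w
      using E(2)[of x w] \<open>exp c = 1\<close> by (simp add: exp_add)
    show "E (x, v) + c = E (x, w) + c" if "exp v = exp w" for x v w
      using E(3)[OF that, of x] by simp
    show "E (x + exp w, w + pi * \<i>) + c = E (x, w) + c" for x w using E(4)[of x w] by simp
    show "\<Theta> (f x) = \<Theta> x + (E (x, \<Theta> x) + c)" for x using c[of x] by (simp add: add.assoc)
  qed (use \<Theta> exp\<Theta> in auto)
qed

section \<open>Curves composed of an arc and its images\<close>

text \<open>
  Write \<open>L (t, u)\<close> for a logarithm of \<open>\<gamma> u - \<gamma> t\<close> that agrees with \<open>\<Theta> (\<gamma> t)\<close> at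
  \<open>u = t + 1\<close>, and \<open>x = \<gamma> s\<close>, \<open>y = \<gamma> (T - 1)\<close>, so that \<open>f y = x\<close>. Applying \<open>f\<close> to the pair
  \<open>(x, y)\<close> leads from \<open>L (s, T - 1)\<close> to \<open>L (s + 1, T)\<close>; by symmetry of the turning function and
  its relation to \<open>\<Theta>\<close>, the increase is \<open>\<Theta> x - \<Theta> y\<close>. On the other hand \<open>\<gamma> T - \<gamma> t\<close> is the
  negative of \<open>\<gamma> t - \<gamma> s\<close>, so \<open>L (t, T) - L (s, t)\<close> is a constant \<open>K\<close> with \<open>exp K = -1\<close>.
  Evaluating it at \<open>t = s + 1\<close> and at \<open>t = T - 1\<close> gives \<open>L (s + 1, T) = \<Theta> x + K\<close> and
  \<open>L (s, T - 1) = \<Theta> y - K\<close>. The increase is therefore also \<open>\<Theta> x - \<Theta> y + 2 * K\<close>, which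
  forces \<open>K = 0\<close>.
\<close>

lemma no_self_meeting_trajectory:
  fixes f :: "complex \<Rightarrow> complex" and \<gamma> :: "real \<Rightarrow> complex"
  assumes cont: "continuous_on UNIV f" and inj: "inj f" and fpf: "\<And>x. f x \<noteq> x"
    and r: "0 < r" and wind: "winding_number (f \<circ> circlepath a r) (f a) = 1"
    and \<gamma>: "continuous_on {0..T} \<gamma>"
    and step: "\<And>t. 0 \<le> t \<Longrightarrow> t \<le> T - 1 \<Longrightarrow> \<gamma> (t + 1) = f (\<gamma> t)"
    and inj\<gamma>: "inj_on \<gamma> {0..<T}"
    and s: "0 \<le> s" "s < 1" and T: "2 \<le> T" and meet: "\<gamma> T = \<gamma> s"
  shows False
proof -
  obtain E :: "complex \<times> complex \<Rightarrow> complex" and \<Theta> where E: "continuous_on UNIV E"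
    and \<Theta>: "continuous_on UNIV \<Theta>"
    and expE: "\<And>x w. f (x + exp w) - f x = exp (w + E (x, w))"
    and per: "\<And>x v w. exp v = exp w \<Longrightarrow> E (x, v) = E (x, w)"
    and sym: "\<And>x w. E (x + exp w, w + pi * \<i>) = E (x, w)"
    and exp\<Theta>: "\<And>x. f x - x = exp (\<Theta> x)"
    and \<Theta>E: "\<And>x. \<Theta> (f x) = \<Theta> x + E (x, \<Theta> x)"
    using displacement_logarithm[OF cont inj fpf r wind] by blast
  \<comment> \<open>The domain of \<open>L\<close>: on the edge \<open>u = T\<close> only the part beyond \<open>s\<close> is kept, which excludes
    the zero of \<open>\<gamma> T - \<gamma> t\<close> at \<open>t = s\<close> without losing convexity.\<close>
  define R where "R = {(t, u). 0 \<le> t \<and> t < u \<and> u \<le> T \<and> (u = T \<longrightarrow> s < t)}"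
  have RI: "(t, u) \<in> R" if "0 \<le> t" "t < u" "u < T \<or> u = T \<and> s < t" for t u
    using that by (auto simp: R_def)
  have "convex R"
  proof (rule convexI)
    fix p q :: "real \<times> real" and v w :: real
    assume pq: "p \<in> R" "q \<in> R" and vw: "0 \<le> v" "0 \<le> w" "v + w = 1"
    obtain t u t' u' where p: "p = (t, u)" and q: "q = (t', u')" by fastforce
    show "v *\<^sub>R p + w *\<^sub>R q \<in> R"
    proof (cases "v = 0 \<or> w = 0")
      case True
      then show ?thesis using pq vw by auto
    next
      case False
      then have pos: "0 < v" "0 < w" using vw by auto
      have 1: "0 \<le> v * t + w * t'" using pq vw by (auto simp: R_def p q)
      have 2: "v * t + w * t' < v * u + w * u'"
        using pq pos by (intro add_strict_mono mult_strict_left_mono) (auto simp: R_def p q)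
      have T_eq: "v * T + w * T = T" and s_eq: "v * s + w * s = s"
        by (simp_all only: distrib_right[symmetric] vw(3) mult_1)
      have 3: "v * u + w * u' \<le> v * T + w * T"
        using pq vw by (intro add_mono mult_left_mono) (auto simp: R_def p q)
      have 4: "s < v * t + w * t'" if eq: "v * u + w * u' = T"
      proof -
        have "v * u \<le> v * T" "w * u' \<le> w * T"
          using pq vw by (auto simp: R_def p q intro!: mult_left_mono)
        then have "v * u = v * T" "w * u' = w * T" using eq T_eq by linarith+
        then have "u = T" "u' = T" using pos by auto
        then have "v * s + w * s < v * t + w * t'"
          using pq pos by (intro add_strict_mono mult_strict_left_mono) (auto simp: R_def p q)
        then show ?thesis using s_eq by simp
      qed
      show ?thesis using 1 2 3 4 T_eq by (auto simp: R_def p q)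
    qed
  qed
  have ne: "\<gamma> u - \<gamma> t \<noteq> 0" if "(t, u) \<in> R" for t u
  proof (cases "u = T")
    case True
    then show ?thesis using that inj_onD[OF inj\<gamma>, of t s] s T meet by (auto simp: R_def)
  next
    case False
    then show ?thesis using that inj_onD[OF inj\<gamma>, of t u] by (auto simp: R_def)
  qed
  have \<gamma>comp: "continuous_on S (\<lambda>x. \<gamma> (g x))" if "continuous_on S g" "g ` S \<subseteq> {0..T}"
    for S :: "'b::topological_space set" and g
    by (rule continuous_on_compose2[OF \<gamma> that])
  obtain L\<^sub>0 where L\<^sub>0: "continuous_on R L\<^sub>0"
    and expL\<^sub>0: "\<And>z. z \<in> R \<Longrightarrow> \<gamma> (snd z) - \<gamma> (fst z) = exp (L\<^sub>0 z)"
  proof (rule continuous_logarithm_on_contractible[of R "\<lambda>z. \<gamma> (snd z) - \<gamma> (fst z)"])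
    show "continuous_on R (\<lambda>z. \<gamma> (snd z) - \<gamma> (fst z))"
      by (intro continuous_intros \<gamma>comp) (auto simp: R_def)
    show "contractible R" using \<open>convex R\<close> by (rule convex_imp_contractible)
    show "\<gamma> (snd z) - \<gamma> (fst z) \<noteq> 0" if "z \<in> R" for z
      using ne[of "fst z" "snd z"] that by simp
  qed blast
  have compL\<^sub>0: "continuous_on S (\<lambda>x. L\<^sub>0 (g x))" if "continuous_on S g" "g ` S \<subseteq> R"
    for S :: "'b::topological_space set" and g
    by (rule continuous_on_compose2[OF L\<^sub>0 that])
  have on_orbit: "(t, t + 1) \<in> R" if "t \<in> {0..T - 1}" for t
    using that s T by (auto intro!: RI)
  obtain k where k: "\<And>t. t \<in> {0..T - 1} \<Longrightarrow> L\<^sub>0 (t, t + 1) = \<Theta> (\<gamma> t) + k"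
  proof (rule logarithms_differ_by_constant[of "{0..T - 1}" "\<lambda>t. L\<^sub>0 (t, t + 1)" "\<lambda>t. \<Theta> (\<gamma> t)"])
    show "continuous_on {0..T - 1} (\<lambda>t. L\<^sub>0 (t, t + 1))"
      using on_orbit by (intro compL\<^sub>0 continuous_intros) auto
    show "continuous_on {0..T - 1} (\<lambda>t. \<Theta> (\<gamma> t))"
      by (intro continuous_on_compose2[OF \<Theta>] \<gamma>comp continuous_intros) auto
    show "exp (L\<^sub>0 (t, t + 1)) = exp (\<Theta> (\<gamma> t))" if "t \<in> {0..T - 1}" for t
      using expL\<^sub>0[OF on_orbit[OF that]] exp\<Theta>[of "\<gamma> t"] step that by simp
  qed auto
  have "exp k = 1"
  proof -
    have "0 \<in> {0..T - 1}" using T by auto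
    then have "exp (L\<^sub>0 (0, 0 + 1)) = exp (\<Theta> (\<gamma> 0))"
      using expL\<^sub>0[OF on_orbit[of 0]] exp\<Theta>[of "\<gamma> 0"] step[of 0] T by simp
    then show ?thesis using k[of 0] T by (simp add: exp_add)
  qed
  define L where "L = (\<lambda>z. L\<^sub>0 z - k)"
  have L: "continuous_on R L" unfolding L_def by (intro continuous_intros L\<^sub>0)
  have expL: "\<gamma> u - \<gamma> t = exp (L (t, u))" if "(t, u) \<in> R" for t u
    using expL\<^sub>0[OF that] \<open>exp k = 1\<close> by (simp add: L_def exp_diff)
  have L\<Theta>: "L (t, t + 1) = \<Theta> (\<gamma> t)" if "0 \<le> t" "t \<le> T - 1" for t
    using k[of t] that by (simp add: L_def)
  have compL: "continuous_on S (\<lambda>x. L (g x))" if "continuous_on S g" "g ` S \<subseteq> R"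
    for S :: "'b::topological_space set" and g
    by (rule continuous_on_compose2[OF L that])

  \<comment> \<open>The pairs that stay in the domain of \<open>L\<close> when \<open>f\<close> is applied. They include \<open>(0, 1)\<close> because
    \<open>2 \<le> T\<close>, and there the normalisation of \<open>L\<close> and \<open>\<Theta>\<close> makes the constant \<open>m\<close> vanish.\<close>
  define R' where "R' = {(t, u). 0 \<le> t \<and> t < u \<and> u \<le> T - 1}"
  have R'_R: "z \<in> R" "(fst z + 1, snd z + 1) \<in> R" if "z \<in> R'" for z
    using that s by (auto simp: R'_def intro!: RI)
  have "R' = {z. 0 \<le> (1, 0) \<bullet> z} \<inter> {z. (1, -1) \<bullet> z < 0} \<inter> {z. (0, 1) \<bullet> z \<le> T - 1}"
    by (auto simp: R'_def)
  then have "convex R'"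
    by (simp add: convex_Int convex_halfspace_ge convex_halfspace_lt convex_halfspace_le)
  obtain m where m: "\<And>z. z \<in> R' \<Longrightarrow> L (fst z + 1, snd z + 1) = L z + E (\<gamma> (fst z), L z) + m"
  proof (rule logarithms_differ_by_constant[of R' "\<lambda>z. L (fst z + 1, snd z + 1)"
        "\<lambda>z. L z + E (\<gamma> (fst z), L z)"])
    show "connected R'" using \<open>convex R'\<close> by (rule convex_connected)
    show "continuous_on R' (\<lambda>z. L (fst z + 1, snd z + 1))"
      using R'_R by (intro compL continuous_intros) auto
    have "continuous_on R' (\<lambda>z. \<gamma> (fst z))"
      by (intro \<gamma>comp continuous_intros) (auto simp: R'_def)
    moreover have "continuous_on R' L"
      using R'_R by (intro continuous_on_subset[OF L]) auto
    ultimately show "continuous_on R' (\<lambda>z. L z + E (\<gamma> (fst z), L z))"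
      by (intro continuous_intros continuous_on_compose2[OF E]) auto
    show "exp (L (fst z + 1, snd z + 1)) = exp (L z + E (\<gamma> (fst z), L z))" if z: "z \<in> R'" for z
    proof -
      obtain t u where tu: "z = (t, u)" by fastforce
      have "exp (L (t, u) + E (\<gamma> t, L (t, u))) = f (\<gamma> t + exp (L (t, u))) - f (\<gamma> t)"
        using expE by simp
      also have "\<gamma> t + exp (L (t, u)) = \<gamma> u"
        using expL[of t u] R'_R(1)[OF z] by (simp add: tu algebra_simps)
      also have "f (\<gamma> u) - f (\<gamma> t) = \<gamma> (u + 1) - \<gamma> (t + 1)"
        using step[of t] step[of u] z by (auto simp: R'_def tu)
      also have "\<dots> = exp (L (t + 1, u + 1))"
        using expL R'_R(2)[OF z] by (simp add: tu)
      finally show ?thesis by (simp add: tu)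
    qed
  qed auto
  have "m = 0"
  proof -
    have "(0, 1) \<in> R'" using T by (auto simp: R'_def)
    from m[OF this] have "L (1, 1 + 1) = L (0, 0 + 1) + E (\<gamma> 0, L (0, 0 + 1)) + m" by simp
    then show ?thesis
      using L\<Theta>[of 0] L\<Theta>[of 1] \<Theta>E[of "\<gamma> 0"] step[of 0] T by simp
  qed

  obtain c where c: "\<And>t. t \<in> {s<..<T} \<Longrightarrow> L (t, T) = L (s, t) + pi * \<i> + c"
  proof (rule logarithms_differ_by_constant[of "{s<..<T}" "\<lambda>t. L (t, T)" "\<lambda>t. L (s, t) + pi * \<i>"])
    show "continuous_on {s<..<T} (\<lambda>t. L (t, T))" "continuous_on {s<..<T} (\<lambda>t. L (s, t) + pi * \<i>)"
      using s by (intro compL continuous_intros; auto intro!: RI)+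
    show "exp (L (t, T)) = exp (L (s, t) + pi * \<i>)" if "t \<in> {s<..<T}" for t
      using expL[of t T, symmetric] expL[of s t, symmetric] meet that s by (simp add: exp_add RI)
  qed auto
  have "(s, T - 1) \<in> R'" using s T by (auto simp: R'_def)
  from m[OF this] have "L (s + 1, T) = L (s, T - 1) + E (\<gamma> s, L (s, T - 1))"
    using \<open>m = 0\<close> by simp
  also have "E (\<gamma> s, L (s, T - 1)) = E (\<gamma> (T - 1), \<Theta> (\<gamma> (T - 1)))"
  proof -
    have 1: "\<gamma> s + exp (L (s, T - 1)) = \<gamma> (T - 1)"
      using expL[of s "T - 1"] s T by (simp add: RI algebra_simps)
    have "exp (L (s, T - 1) + pi * \<i>) = \<gamma> s - \<gamma> (T - 1)"
      using 1 by (simp add: exp_add algebra_simps)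
    also have "\<dots> = exp (\<Theta> (\<gamma> (T - 1)))"
      using exp\<Theta>[of "\<gamma> (T - 1)"] step[of "T - 1"] T meet by simp
    finally show ?thesis
      using sym[of "\<gamma> s" "L (s, T - 1)"] 1 per by metis
  qed
  also have "\<dots> = \<Theta> (\<gamma> s) - \<Theta> (\<gamma> (T - 1))"
    using \<Theta>E[of "\<gamma> (T - 1)"] step[of "T - 1"] T meet by simp
  finally have "L (s + 1, T) = L (s, T - 1) + \<Theta> (\<gamma> s) - \<Theta> (\<gamma> (T - 1))" by simp
  moreover have "L (s, s + 1) = \<Theta> (\<gamma> s)" "L (T - 1, T) = \<Theta> (\<gamma> (T - 1))"
    using L\<Theta>[of s] L\<Theta>[of "T - 1"] s T by auto
  moreover have "L (s + 1, T) = L (s, s + 1) + pi * \<i> + c" "L (T - 1, T) = L (s, T - 1) + pi * \<i> + c"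
    using c[of "s + 1"] c[of "T - 1"] s T by auto
  ultimately have "\<Theta> (\<gamma> s) + (pi * \<i> + c) = \<Theta> (\<gamma> s) - (pi * \<i> + c)"
    by (simp add: add.assoc)
  then have "pi * \<i> + c = - (pi * \<i> + c)"
    by (simp only: diff_conv_add_uminus add_left_cancel)
  then have "2 * (pi * \<i> + c) = 0" by (simp only: eq_neg_iff_add_eq_0 mult_2)
  then have "pi * \<i> + c = 0" by (metis mult_eq_0_iff zero_neq_numeral)
  then have "L (s + 1, T) = L (s, s + 1)"
    using c[of "s + 1"] s T by (simp add: add.assoc)
  then have "\<gamma> T - \<gamma> (s + 1) = \<gamma> (s + 1) - \<gamma> s"
    using expL[of "s + 1" T] expL[of s "s + 1"] s T by (simp add: RI)
  then have "\<gamma> (s + 1) - \<gamma> s = - (\<gamma> (s + 1) - \<gamma> s)" using meet by simp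
  then have "2 * (\<gamma> (s + 1) - \<gamma> s) = 0" by (simp only: eq_neg_iff_add_eq_0 mult_2)
  then have "\<gamma> (s + 1) - \<gamma> s = 0" by (metis mult_eq_0_iff zero_neq_numeral)
  then show False using ne[of s "s + 1"] s T by (simp add: RI)
qed

text \<open>
  Let a disc around \<open>x\<close> grow until it touches its image. The open disc \<open>B\<close> reached then is disjoint
  from \<open>f ` B\<close>, and its boundary circle contains a point \<open>y\<close> together with \<open>f y\<close>. The arc consists
  of the radii from \<open>y\<close> to \<open>x\<close> and from \<open>x\<close> to \<open>f y\<close>.
\<close>

lemma translation_arc_exists:
  fixes f :: "complex \<Rightarrow> complex"
  assumes cont: "continuous_on UNIV f" and inj: "inj f" and fpf: "\<And>x. f x \<noteq> x"
  obtains \<beta> where "arc \<beta>" "x \<in> path_image \<beta>" "pathfinish \<beta> = f (pathstart \<beta>)"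
    "\<And>t u. t \<in> {0..<1} \<Longrightarrow> u \<in> {0..<1} \<Longrightarrow> f (\<beta> t) \<noteq> \<beta> u"
proof -
  \<comment> \<open>The radius of the smallest closed disc around \<open>x\<close> containing both \<open>z\<close> and \<open>f z\<close>.\<close>
  define \<rho> where "\<rho> = (\<lambda>z. max (dist x z) (dist x (f z)))"
  have "continuous_on (cball x (\<rho> x)) \<rho>"
    unfolding \<rho>_def by (intro continuous_intros continuous_on_subset[OF cont]) auto
  moreover have "cball x (\<rho> x) \<noteq> {}" by (simp add: \<rho>_def)
  ultimately obtain y where y: "y \<in> cball x (\<rho> x)" "\<And>z. z \<in> cball x (\<rho> x) \<Longrightarrow> \<rho> y \<le> \<rho> z"
    using continuous_attains_inf[of "cball x (\<rho> x)" \<rho>] by auto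
  have y_min: "\<rho> y \<le> \<rho> z" for z
  proof (cases "z \<in> cball x (\<rho> x)")
    case False
    then have "\<rho> x \<le> \<rho> z" unfolding \<rho>_def by auto
    moreover have "\<rho> y \<le> \<rho> x" by (rule y(2)) (simp add: \<rho>_def)
    ultimately show ?thesis by simp
  qed (rule y(2))
  define r where "r = \<rho> y"
  have r_min: "r \<le> \<rho> z" for z using y_min by (simp add: r_def)
  have "r > 0"
  proof (rule ccontr)
    assume "\<not> r > 0"
    moreover have "dist x y \<le> r" "dist x (f y) \<le> r"
      by (auto simp: r_def \<rho>_def)
    ultimately have "dist x y \<le> 0" "dist x (f y) \<le> 0" by linarith+
    then show False using fpf[of y] by simp
  qed
  have free: "f z \<notin> ball x r" if "z \<in> ball x r" for z
    using r_min[of z] that by (auto simp: \<rho>_def)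
  have closure: "closure (ball x r) = cball x r" using \<open>r > 0\<close> by simp
  have free_source: "f z \<notin> ball x r" if "z \<in> cball x r" for z
  proof
    assume "f z \<in> ball x r"
    with that have "f -` ball x r \<inter> closure (ball x r) \<noteq> {}"
      unfolding closure by auto
    moreover have "open (f -` ball x r)"
      using cont by (simp add: open_vimage)
    ultimately have "f -` ball x r \<inter> ball x r \<noteq> {}"
      using open_Int_closure_eq_empty by blast
    then show False using free by auto
  qed
  have free_target: "f z \<notin> cball x r" if "z \<in> ball x r" for z
  proof
    assume "f z \<in> cball x r"
    with that have "f ` ball x r \<inter> closure (ball x r) \<noteq> {}"
      unfolding closure by blast
    moreover have "open (f ` ball x r)"
      by (rule invariance_of_domain) (auto intro: continuous_on_subset[OF cont] inj_on_subset[OF inj])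
    ultimately have "f ` ball x r \<inter> ball x r \<noteq> {}"
      using open_Int_closure_eq_empty by blast
    then show False using free by auto
  qed
  have cballs: "y \<in> cball x r" "f y \<in> cball x r"
    by (auto simp: r_def \<rho>_def)
  then have "y \<notin> ball x r" "f y \<notin> ball x r"
    using free_target[of y] free_source[of y] by blast+
  with cballs have "dist x y = r" "dist x (f y) = r" by auto
  then have spheres: "norm (y - x) = r" "norm (f y - x) = r"
    by (simp_all add: dist_norm norm_minus_commute)
  define \<beta> where "\<beta> = linepath y x +++ linepath x (f y)"
  have "arc \<beta>" unfolding \<beta>_def
  proof (rule arc_join)
    show "arc (linepath y x)" "arc (linepath x (f y))"
      using spheres \<open>r > 0\<close> by (auto intro!: arc_linepath)
    have "z = x" if "z \<in> closed_segment x y" "z \<in> closed_segment x (f y)" for z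
    proof -
      obtain v where v: "0 \<le> v" "z - x = v *\<^sub>R (y - x)"
        using \<open>z \<in> closed_segment x y\<close> by (auto simp: closed_segment_def algebra_simps)
      obtain w where w: "0 \<le> w" "z - x = w *\<^sub>R (f y - x)"
        using \<open>z \<in> closed_segment x (f y)\<close> by (auto simp: closed_segment_def algebra_simps)
      have "v * r = norm (z - x)" using v spheres(1) by simp
      moreover have "w * r = norm (z - x)" using w spheres(2) by simp
      ultimately have "v * r = w * r" by simp
      then have "v = w" using \<open>r > 0\<close> by (metis less_irrefl mult_right_cancel)
      have "v *\<^sub>R (y - f y) = v *\<^sub>R (y - x) - v *\<^sub>R (f y - x)"
        by (simp add: algebra_simps)
      also have "v *\<^sub>R (y - x) = v *\<^sub>R (f y - x)" using v(2) w(2) \<open>v = w\<close> by metis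
      finally have "v *\<^sub>R (y - f y) = 0" by (simp only: diff_self)
      then have "v = 0" using fpf[of y] by (metis right_minus_eq scaleR_eq_0_iff)
      then show "z = x" using v(2) by simp
    qed
    then show "path_image (linepath y x) \<inter> path_image (linepath x (f y)) \<subseteq> {pathstart (linepath x (f y))}"
      by (auto simp: closed_segment_commute)
  qed simp
  have seg: "z \<in> ball x r \<union> {p}" if p: "norm (p - x) = r" and z: "z \<in> closed_segment x p" for z p
  proof -
    obtain v where v: "0 \<le> v" "v \<le> 1" "z - x = v *\<^sub>R (p - x)"
      using z by (auto simp: closed_segment_def algebra_simps)
    show ?thesis
    proof (cases "v = 1")
      case False
      then have "norm (z - x) < r" using v p \<open>r > 0\<close> by simp
      then show ?thesis by (simp add: dist_norm norm_minus_commute)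
    qed (use v in auto)
  qed
  have image: "path_image \<beta> \<subseteq> ball x r \<union> {y, f y}"
  proof -
    have "closed_segment x y \<subseteq> ball x r \<union> {y}" "closed_segment x (f y) \<subseteq> ball x r \<union> {f y}"
      using seg[OF spheres(1)] seg[OF spheres(2)] by blast+
    moreover have "path_image \<beta> = closed_segment x y \<union> closed_segment x (f y)"
      by (simp add: \<beta>_def path_image_join closed_segment_commute[of y x])
    ultimately show ?thesis by blast
  qed
  have ends: "\<beta> 0 = y" "\<beta> 1 = f y" by (auto simp: \<beta>_def joinpaths_def linepath_def)
  have inside: "\<beta> t \<in> ball x r \<union> {y}" if t: "t \<in> {0..<1}" for t
  proof -
    have "\<beta> t \<noteq> \<beta> 1"
      using \<open>arc \<beta>\<close> t by (auto simp: arc_def dest: inj_onD)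
    moreover have "\<beta> t \<in> path_image \<beta>" using t by (auto simp: path_image_def)
    ultimately show ?thesis using image ends by auto
  qed
  show thesis
  proof
    show "x \<in> path_image \<beta>" by (simp add: \<beta>_def path_image_join)
    show "f (\<beta> t) \<noteq> \<beta> u" if "t \<in> {0..<1}" "u \<in> {0..<1}" for t u
      using inside[OF that(1)] inside[OF that(2)] free free_source[of y] free_target cballs fpf[of y]
      by (metis Un_iff singletonD)
  qed (use \<open>arc \<beta>\<close> in \<open>auto simp: \<beta>_def\<close>)
qed

text \<open>
  The curve \<open>\<gamma>\<close> satisfies \<open>\<gamma> (t + 1) = f (\<gamma> t)\<close> and extends a translation arc through the periodic
  point, so it meets itself. It is injective on the first two pieces by the properties of the arc;
  hence its first return happens at a time \<open>T \<ge> 2\<close>, and the point that it meets lies on the first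
  piece since otherwise applying the inverse of \<open>f\<close> would give an earlier return.
\<close>

lemma no_periodic_point:
  fixes f :: "complex \<Rightarrow> complex"
  assumes cont: "continuous_on UNIV f" and inj: "inj f" and fpf: "\<And>x. f x \<noteq> x"
    and r: "0 < r" and wind: "winding_number (f \<circ> circlepath a r) (f a) = 1"
    and n: "n \<ge> 1" and periodic: "(f ^^ n) x = x"
  shows False
proof -
  obtain \<beta> where arc: "arc \<beta>" and x: "x \<in> path_image \<beta>"
    and fin: "pathfinish \<beta> = f (pathstart \<beta>)"
    and free: "\<And>t u. t \<in> {0..<1} \<Longrightarrow> u \<in> {0..<1} \<Longrightarrow> f (\<beta> t) \<noteq> \<beta> u"
    using translation_arc_exists[OF cont inj fpf] by blast
  define \<gamma> where "\<gamma> = (\<lambda>t::real. (f ^^ nat \<lfloor>t\<rfloor>) (\<beta> (t - \<lfloor>t\<rfloor>)))"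
  have step: "\<gamma> (t + 1) = f (\<gamma> t)" if "0 \<le> t" for t
  proof -
    have "nat \<lfloor>t + 1\<rfloor> = Suc (nat \<lfloor>t\<rfloor>)" using that by (simp add: nat_add_distrib)
    then show ?thesis by (simp add: \<gamma>_def)
  qed
  have steps: "\<gamma> (t + real k) = (f ^^ k) (\<gamma> t)" if "0 \<le> t" for t k
  proof (induction k)
    case (Suc k)
    have "\<gamma> (t + real (Suc k)) = \<gamma> ((t + real k) + 1)" by (simp add: algebra_simps)
    then show ?case using step[of "t + real k"] Suc that by simp
  qed simp
  have inj_pow: "inj (f ^^ k)" for k using inj by (rule inj_fn)
  have \<gamma>\<beta>: "\<gamma> t = \<beta> t" if "t \<in> {0..1}" for t
  proof (cases "t = 1")
    case True
    then show ?thesis using fin by (simp add: \<gamma>_def pathstart_def pathfinish_def)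
  next
    case False
    then have "\<lfloor>t\<rfloor> = 0" using that by (simp add: floor_eq_iff)
    then show ?thesis by (simp add: \<gamma>_def)
  qed
  have \<beta>: "continuous_on {0..1} \<beta>" and inj\<beta>: "inj_on \<beta> {0..1}"
    using arc by (auto simp: arc_def path_def)
  have cont_pow: "continuous_on UNIV (f ^^ k)" for k
  proof (induction k)
    case (Suc k)
    show ?case unfolding funpow.simps by (rule continuous_on_compose[OF Suc continuous_on_subset[OF cont]]) auto
  qed (simp add: id_def)
  have cont\<gamma>: "continuous_on {0..real k} \<gamma>" for k
  proof (induction k)
    case (Suc k)
    have "continuous_on {real k..real k + 1} (\<lambda>t. (f ^^ k) (\<beta> (t - real k)))"
      by (intro continuous_on_compose2[OF cont_pow] continuous_on_compose2[OF \<beta>] continuous_intros) auto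
    moreover have "(f ^^ k) (\<beta> (t - real k)) = \<gamma> t" if "t \<in> {real k..real k + 1}" for t
      using steps[of "t - real k" k] \<gamma>\<beta>[of "t - real k"] that by simp
    ultimately have "continuous_on {real k..real k + 1} \<gamma>"
      by (rule continuous_on_eq)
    then have "continuous_on ({0..real k} \<union> {real k..real k + 1}) \<gamma>"
      by (intro continuous_on_closed_Un Suc) auto
    moreover have "{0..real k} \<union> {real k..real k + 1} = {0..real (Suc k)}" by auto
    ultimately show ?case by simp
  qed auto
  have inj2: "t = u" if "0 \<le> t" "t \<le> u" "u < 2" "\<gamma> t = \<gamma> u" for t u
  proof -
    have late: "\<gamma> v = f (\<beta> (v - 1))" if "1 \<le> v" "v < 2" for v
      using step[of "v - 1"] \<gamma>\<beta>[of "v - 1"] that by simp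
    consider "u < 1" | "1 \<le> t" | "t < 1" "1 \<le> u" by linarith
    then show ?thesis
    proof cases
      case 1
      then show ?thesis using that \<gamma>\<beta>[of t] \<gamma>\<beta>[of u] inj_onD[OF inj\<beta>, of t u] by simp
    next
      case 2
      then have "\<beta> (t - 1) = \<beta> (u - 1)" using that late[of t] late[of u] injD[OF inj] by simp
      then show ?thesis using 2 that inj_onD[OF inj\<beta>, of "t - 1" "u - 1"] by simp
    next
      case 3
      then show ?thesis using that \<gamma>\<beta>[of t] late[of u] free[of "u - 1" t] by simp
    qed
  qed
  \<comment> \<open>Removing the integer part of \<open>t\<close> from both times preserves a meeting.\<close>
  have reduce: "\<exists>t' u'. t' \<in> {0..1} \<and> u' \<in> {2..u} \<and> \<gamma> t' = \<gamma> u'"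
    if tu: "0 \<le> t" "t < u" "\<gamma> t = \<gamma> u" for t u
  proof -
    define k where "k = nat \<lfloor>t\<rfloor>"
    have k: "real k \<le> t" "t < real k + 1" using tu(1) by (auto simp: k_def)
    have "(f ^^ k) (\<gamma> (t - real k)) = (f ^^ k) (\<gamma> (u - real k))"
      using steps[of "t - real k" k] steps[of "u - real k" k] tu k by simp
    then have eq: "\<gamma> (t - real k) = \<gamma> (u - real k)" using injD[OF inj_pow] by blast
    moreover have "2 \<le> u - real k"
      using inj2[of "t - real k" "u - real k"] eq tu k by force
    ultimately show ?thesis
      using k tu by (intro exI[of _ "t - real k"] exI[of _ "u - real k"]) auto
  qed
  define K where "K = {z \<in> {0..1} \<times> {2..real n + 1}. \<gamma> (fst z) - \<gamma> (snd z) = 0}"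
  have "K \<noteq> {}"
  proof -
    obtain \<tau> where \<tau>: "\<tau> \<in> {0..1}" "\<beta> \<tau> = x" using x by (auto simp: path_image_def)
    then have "\<gamma> \<tau> = \<gamma> (\<tau> + real n)" using steps[of \<tau> n] \<gamma>\<beta>[of \<tau>] periodic by simp
    from reduce[OF _ _ this] obtain t u where "t \<in> {0..1}" "u \<in> {2..\<tau> + real n}" "\<gamma> t = \<gamma> u"
      using \<tau> n by auto
    then have "(t, u) \<in> K" using \<tau> by (auto simp: K_def)
    then show ?thesis by auto
  qed
  moreover have "compact K"
  proof -
    have "continuous_on ({0..1} \<times> {2..real n + 1}) (\<lambda>z. \<gamma> (fst z) - \<gamma> (snd z))"
      using n by (intro continuous_intros continuous_on_compose2[OF cont\<gamma>[of "Suc n"]]) auto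
    then have "closed K"
      unfolding K_def by (intro continuous_closed_preimage_constant closed_Times) auto
    moreover have "K \<subseteq> {0..1} \<times> {2..real n + 1}" by (auto simp: K_def)
    ultimately show ?thesis
      by (metis compact_Icc compact_Int_closed compact_Times inf.absorb_iff2)
  qed
  moreover have "continuous_on K snd" by (intro continuous_intros)
  ultimately obtain z where z: "z \<in> K" "\<And>z'. z' \<in> K \<Longrightarrow> snd z \<le> snd z'"
    using continuous_attains_inf by metis
  obtain s T where sT: "z = (s, T)" by fastforce
  have T: "2 \<le> T" "T \<le> real n + 1" "0 \<le> s" "s \<le> 1" "\<gamma> T = \<gamma> s"
    using z(1) by (auto simp: K_def sT)
  have distinct: "\<gamma> t \<noteq> \<gamma> u" if tu: "0 \<le> t" "t < u" "u < T" for t u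
  proof
    assume "\<gamma> t = \<gamma> u"
    from reduce[OF tu(1,2) this] obtain t' u' where "t' \<in> {0..1}" "u' \<in> {2..u}" "\<gamma> t' = \<gamma> u'"
      by blast
    then show False using z(2)[of "(t', u')"] T tu by (auto simp: K_def sT)
  qed
  have "s \<noteq> 1"
  proof
    assume "s = 1"
    then have "f (\<gamma> 0) = f (\<gamma> (T - 1))" using step[of 0] step[of "T - 1"] T by simp
    then have "\<gamma> 0 = \<gamma> (T - 1)" using inj by (simp add: injD)
    then show False using distinct[of 0 "T - 1"] T by simp
  qed
  show False
  proof (rule no_self_meeting_trajectory[OF cont inj fpf r wind, of T \<gamma> s])
    show "continuous_on {0..T} \<gamma>"
      by (rule continuous_on_subset[OF cont\<gamma>[of "Suc n"]]) (use T in auto)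
    show "inj_on \<gamma> {0..<T}"
      by (rule linorder_inj_onI) (use distinct in auto)
  qed (use T step \<open>s \<noteq> 1\<close> in auto)
qed

section \<open>Stretched coordinates\<close>

text \<open>
  The difference is \<open>v *\<^sub>R (y - x) + (w - v) *\<^sub>R y\<close>, and the two summands enclose an angle of at
  most a right angle because \<open>y\<close> is the longer vector.
\<close>

lemma radial_stretch_expands:
  fixes x y :: "'a::real_inner"
  assumes "0 \<le> v" "v \<le> w" "norm x \<le> norm y"
  shows "v * norm (y - x) \<le> norm (w *\<^sub>R y - v *\<^sub>R x)"
proof -
  have "x \<bullet> y \<le> norm x * norm y" by (rule norm_cauchy_schwarz)
  also have "\<dots> \<le> y \<bullet> y"
    using assms(3) by (simp add: dot_square_norm power2_eq_square mult_right_mono)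
  finally have "0 \<le> (y - x) \<bullet> y" by (simp add: inner_diff_left)
  then have "0 \<le> v * (w - v) * ((y - x) \<bullet> y)" using assms by simp
  moreover have "w *\<^sub>R y - v *\<^sub>R x = v *\<^sub>R (y - x) + (w - v) *\<^sub>R y" by (simp add: algebra_simps)
  ultimately have "(v *\<^sub>R (y - x)) \<bullet> (v *\<^sub>R (y - x)) \<le> (w *\<^sub>R y - v *\<^sub>R x) \<bullet> (w *\<^sub>R y - v *\<^sub>R x)"
    using inner_ge_zero[of "(w - v) *\<^sub>R y"]
    by (simp add: inner_add_left inner_add_right inner_commute mult.assoc)
  then have "norm (v *\<^sub>R (y - x)) \<le> norm (w *\<^sub>R y - v *\<^sub>R x)" by (simp only: norm_le)
  then show ?thesis using assms by simp
qed

text \<open>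
  The coordinates stretch radially by a factor \<open>s (norm x)\<close> that increases with the distance from
  the origin, so a vector grows at least by the factor belonging to its end point nearer to the
  origin. The factor has to be at least \<open>1 / dist (f x) x\<close> at that radius, for all \<open>x\<close>
  simultaneously. This is possible since only a compact set of points \<open>x\<close> has one of \<open>x\<close> and \<open>f x\<close>
  within a given radius.
\<close>

lemma displacement_at_least_one_coordinates:
  fixes f :: "'a::euclidean_space \<Rightarrow> 'a"
  assumes hom: "homeomorphism UNIV UNIV f f'" and fpf: "\<And>x. f x \<noteq> x"
  obtains \<phi> \<psi> :: "'a \<Rightarrow> 'a" where "homeomorphism UNIV UNIV \<phi> \<psi>" "\<And>x. 1 \<le> dist (\<phi> (f x)) (\<phi> x)"
proof -
  have contf: "continuous_on UNIV f" and contf': "continuous_on UNIV f'" and f'f: "f' (f x) = x" for x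
    using hom by (auto simp: homeomorphism_def)
  \<comment> \<open>The penalty for points beyond radius \<open>r\<close> makes the infimum \<open>\<mu>\<close> of the displacement near the
    disc of radius \<open>r\<close> a Lipschitz function of \<open>r\<close>.\<close>
  define F where "F = (\<lambda>x r. dist (f x) x + max 0 (min (norm x) (norm (f x)) - r))"
  define \<mu> where "\<mu> = (\<lambda>r. INF x. F x r)"
  have bdd: "bdd_below (range (\<lambda>x. F x r))" for r
    by (rule bdd_belowI[of _ 0]) (auto simp: F_def)
  have \<mu>_le: "\<mu> r \<le> F x r" for x r
    unfolding \<mu>_def by (rule cINF_lower[OF bdd]) simp
  have \<mu>_ge: "m \<le> \<mu> r" if "\<And>x. m \<le> F x r" for m r
    unfolding \<mu>_def by (rule cINF_greatest) (use that in auto)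
  have \<mu>_pos: "0 < \<mu> r" for r
  proof -
    define K where "K = cball 0 (\<bar>r\<bar> + 1) \<union> f' ` cball 0 (\<bar>r\<bar> + 1)"
    have "compact K" unfolding K_def
      by (intro compact_Un compact_continuous_image continuous_on_subset[OF contf']) auto
    moreover have "K \<noteq> {}" by (auto simp: K_def)
    moreover have "continuous_on K (\<lambda>x. dist (f x) x)"
      by (intro continuous_intros continuous_on_subset[OF contf]) auto
    ultimately obtain y where y: "\<And>x. x \<in> K \<Longrightarrow> dist (f y) y \<le> dist (f x) x"
      using continuous_attains_inf[of K "\<lambda>x. dist (f x) x"] by blast
    have "min 1 (dist (f y) y) \<le> F x r" for x
    proof (cases "x \<in> K")
      case True
      then show ?thesis using y[OF True] by (auto simp: F_def)
    next
      case False
      then have "f x \<notin> cball 0 (\<bar>r\<bar> + 1)" using f'f[of x] unfolding K_def by (metis UnI2 imageI)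
      then have "\<bar>r\<bar> + 1 < norm x" "\<bar>r\<bar> + 1 < norm (f x)"
        using False by (auto simp: K_def)
      then have "r + 1 \<le> norm x" "r + 1 \<le> norm (f x)" by linarith+
      then have "1 \<le> min (norm x) (norm (f x)) - r" by (simp add: le_diff_eq add.commute)
      then show ?thesis using zero_le_dist[of "f x" x] unfolding F_def by linarith
    qed
    then have "min 1 (dist (f y) y) \<le> \<mu> r" by (rule \<mu>_ge)
    moreover have "0 < min 1 (dist (f y) y)" using fpf[of y] by simp
    ultimately show ?thesis by linarith
  qed
  have \<mu>_mono: "\<mu> r' \<le> \<mu> r" if "r \<le> r'" for r r'
  proof (rule \<mu>_ge)
    fix x
    have "F x r' \<le> F x r" unfolding F_def using that by (intro add_left_mono max.mono) auto
    then show "\<mu> r' \<le> F x r" using \<mu>_le[of r' x] by linarith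
  qed
  have \<mu>_lip: "\<mu> r \<le> \<mu> r' + \<bar>r - r'\<bar>" for r r'
  proof -
    have "\<mu> r - \<bar>r - r'\<bar> \<le> F x r'" for x
    proof -
      have "max 0 (c - r) \<le> max 0 (c - r') + \<bar>r - r'\<bar>" for c
        using abs_ge_minus_self[of "r - r'"] by (auto simp: max_def)
      then have "F x r \<le> F x r' + \<bar>r - r'\<bar>" unfolding F_def add.assoc by (rule add_left_mono)
      then show ?thesis using \<mu>_le[of r x] by linarith
    qed
    then have "\<mu> r - \<bar>r - r'\<bar> \<le> \<mu> r'" by (rule \<mu>_ge)
    then show ?thesis by simp
  qed
  have cont\<mu>: "continuous_on UNIV \<mu>"
  proof (rule lipschitz_on_continuous_on[of 1], rule lipschitz_onI)
    show "dist (\<mu> r) (\<mu> r') \<le> 1 * dist r r'" for r r'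
      using \<mu>_lip[of r r'] \<mu>_lip[of r' r] by (simp add: dist_real_def abs_le_iff)
  qed simp
  define s where "s = (\<lambda>r. 1 + 1 / \<mu> r)"
  have s: "1 \<le> s r" for r using \<mu>_pos[of r] by (simp add: s_def)
  have s_mono: "s r \<le> s r'" if "r \<le> r'" for r r'
    unfolding s_def using \<mu>_mono[OF that] \<mu>_pos[of r'] by (intro add_left_mono divide_left_mono) auto
  have conts: "continuous_on UNIV s"
    unfolding s_def using \<mu>_pos by (intro continuous_intros cont\<mu>) (auto simp: less_imp_neq[symmetric])
  define \<phi> where "\<phi> = (\<lambda>x::'a. s (norm x) *\<^sub>R x)"
  have cont\<phi>: "continuous_on UNIV \<phi>"
    unfolding \<phi>_def by (intro continuous_intros continuous_on_compose2[OF conts]) auto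
  have expand: "s (min (norm x) (norm y)) * dist x y \<le> dist (\<phi> x) (\<phi> y)" for x y
  proof -
    have *: "s (norm x) * dist x y \<le> dist (\<phi> x) (\<phi> y)" if "norm x \<le> norm y" for x y
      using radial_stretch_expands[OF order_trans[OF zero_le_one s] s_mono[OF that] that]
      by (simp add: \<phi>_def dist_norm norm_minus_commute)
    show ?thesis
      using *[of x y] *[of y x] by (cases "norm x \<le> norm y") (auto simp: dist_commute)
  qed
  have expand1: "dist x y \<le> dist (\<phi> x) (\<phi> y)" for x y
    using expand[of x y] mult_right_mono[OF s zero_le_dist, of x y "min (norm x) (norm y)"] by simp
  have "inj \<phi>"
    by (rule injI) (use expand1 in \<open>metis dist_eq_0_iff dist_le_zero_iff\<close>)
  have "y \<in> range \<phi>" for y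
  proof (cases "y = 0")
    case True
    then have "y = \<phi> 0" by (simp add: \<phi>_def)
    then show ?thesis by blast
  next
    case False
    have "\<exists>t\<ge>0. t \<le> norm y \<and> t * s t = norm y"
    proof (rule IVT')
      show "norm y \<le> norm y * s (norm y)" using s[of "norm y"] by (simp add: mult_le_cancel_left1)
      show "continuous_on {0..norm y} (\<lambda>t. t * s t)"
        by (intro continuous_intros continuous_on_subset[OF conts]) auto
    qed auto
    then obtain t where t: "0 \<le> t" "t * s t = norm y" by blast
    have "\<phi> ((t / norm y) *\<^sub>R y) = y"
      using t False by (simp add: \<phi>_def mult.commute[of t])
    then show ?thesis by (metis rangeI)
  qed
  then have "surj \<phi>" by blast
  have inv: "\<phi> (inv \<phi> x) = x" "inv \<phi> (\<phi> x) = x" for x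
    using \<open>inj \<phi>\<close> \<open>surj \<phi>\<close> by (auto simp: surj_f_inv_f)
  have "homeomorphism UNIV UNIV \<phi> (inv \<phi>)"
  proof (rule homeomorphismI)
    show "continuous_on UNIV (inv \<phi>)"
    proof (rule lipschitz_on_continuous_on[of 1], rule lipschitz_onI)
      show "dist (inv \<phi> x) (inv \<phi> y) \<le> 1 * dist x y" for x y
        using expand1[of "inv \<phi> x" "inv \<phi> y"] inv by simp
    qed simp
  qed (use cont\<phi> inv in auto)
  moreover have "1 \<le> dist (\<phi> (f x)) (\<phi> x)" for x
  proof -
    define r where "r = min (norm (f x)) (norm x)"
    have "\<mu> r \<le> dist (f x) x" using \<mu>_le[of r x] by (simp add: F_def r_def min.commute)
    then have "1 \<le> (1 / \<mu> r) * dist (f x) x" using \<mu>_pos[of r] by (simp add: field_simps)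
    also have "\<dots> \<le> s r * dist (f x) x" by (rule mult_right_mono) (auto simp: s_def)
    also have "\<dots> \<le> dist (\<phi> (f x)) (\<phi> x)" unfolding r_def by (rule expand)
    finally show ?thesis .
  qed
  ultimately show thesis by (rule that)
qed

section \<open>Closed chains\<close>

text \<open>
  Among all closed chains with jumps from \<open>A (p (i - 1))\<close> to \<open>B (p i)\<close> shorter than \<open>\<epsilon>\<close>, take one
  of minimal length. If two of its jumps had a common point, then exchanging their targets would not
  increase the sum of the two lengths, so one of the exchanged jumps would again be shorter than
  \<open>\<epsilon>\<close>. Each of them closes up a shorter chain.
\<close>

lemma closed_chain_with_disjoint_jumps:
  fixes A B :: "'a \<Rightarrow> 'b::real_normed_vector" and m :: nat
  assumes "m \<ge> 1" "q m = q 0" "\<And>i. i \<in> {1..m} \<Longrightarrow> dist (A (q (i - 1))) (B (q i)) < \<epsilon>"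
  shows "\<exists>n\<ge>1::nat. \<exists>p. p n = p 0 \<and>
    (\<forall>i\<in>{1..n}. dist (A (p (i - 1))) (B (p i)) < \<epsilon>) \<and>
    (\<forall>i\<in>{1..n}. \<forall>j\<in>{1..n}. i \<noteq> j \<longrightarrow>
      closed_segment (A (p (i - 1))) (B (p i)) \<inter> closed_segment (A (p (j - 1))) (B (p j)) = {})"
proof -
  define chain where "chain = (\<lambda>n p. n \<ge> (1::nat) \<and> p n = p 0 \<and>
    (\<forall>i\<in>{1..n}. dist (A (p (i - 1))) (B (p i)) < \<epsilon>))"
  have "chain m q" unfolding chain_def using assms by blast
  then have "\<exists>n. \<exists>p. chain n p" by blast
  then have "\<exists>p. chain (LEAST n. \<exists>p. chain n p) p" by (rule LeastI_ex)
  then obtain n p where np: "chain n p" and least: "\<And>k q. chain k q \<Longrightarrow> n \<le> k"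
    using Least_le[of "\<lambda>n. \<exists>p. chain n p"] by blast
  have jump: "dist (A (p (i - 1))) (B (p i)) < \<epsilon>" if "1 \<le> i" "i \<le> n" for i
    using np that by (auto simp: chain_def)
  have disjoint: "closed_segment (A (p (i - 1))) (B (p i)) \<inter> closed_segment (A (p (j - 1))) (B (p j)) = {}"
    if ij: "1 \<le> i" "i < j" "j \<le> n" for i j
  proof (rule ccontr)
    assume "\<not> ?thesis"
    then obtain z where z: "z \<in> closed_segment (A (p (i - 1))) (B (p i))"
      "z \<in> closed_segment (A (p (j - 1))) (B (p j))" by blast
    have split: "dist a b = dist a z + dist z b" if "z \<in> closed_segment a b" for a b :: 'b
    proof -
      obtain u where u: "0 \<le> u" "u \<le> 1" "z = (1 - u) *\<^sub>R a + u *\<^sub>R b"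
        using \<open>z \<in> closed_segment a b\<close> by (auto simp: closed_segment_def)
      have "a - z = u *\<^sub>R (a - b)" "z - b = (1 - u) *\<^sub>R (a - b)"
        by (simp_all add: u(3) algebra_simps)
      then have "dist a z = u * dist a b" "dist z b = (1 - u) * dist a b"
        using u(1,2) by (simp_all add: dist_norm)
      then show ?thesis by (simp add: algebra_simps)
    qed
    have "dist (A (p (i - 1))) (B (p j)) \<le> dist (A (p (i - 1))) z + dist z (B (p j))"
      "dist (A (p (j - 1))) (B (p i)) \<le> dist (A (p (j - 1))) z + dist z (B (p i))"
      by (auto intro: dist_triangle)
    then have "dist (A (p (i - 1))) (B (p j)) < \<epsilon> \<or> dist (A (p (j - 1))) (B (p i)) < \<epsilon>"
      using split[OF z(1)] split[OF z(2)] jump[of i] jump[of j] ij by linarith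
    then show False
    proof
      assume short: "dist (A (p (i - 1))) (B (p j)) < \<epsilon>"
      \<comment> \<open>Skip the part of the chain between the two jumps.\<close>
      define q where "q = (\<lambda>k. if k < i then p k else p (k + (j - i)))"
      have "dist (A (q (k - 1))) (B (q k)) < \<epsilon>" if k: "1 \<le> k" "k \<le> n - (j - i)" for k
      proof -
        consider "k < i" | "k = i" | "k > i" by linarith
        then show ?thesis
        proof cases
          case 1
          then show ?thesis using jump[of k] k ij by (auto simp: q_def)
        next
          case 2
          then show ?thesis using short ij by (auto simp: q_def)
        next
          case 3
          then show ?thesis using jump[of "k + (j - i)"] k ij by (auto simp: q_def)
        qed
      qed
      then have "chain (n - (j - i)) q"
        using np ij by (auto simp: chain_def q_def)
      then show False using least ij by fastforce
    next
      assume short: "dist (A (p (j - 1))) (B (p i)) < \<epsilon>"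
      \<comment> \<open>Keep only the part of the chain between the two jumps.\<close>
      define q where "q = (\<lambda>k. if k = 0 then p (j - 1) else p (i - 1 + k))"
      have "dist (A (q (k - 1))) (B (q k)) < \<epsilon>" if k: "1 \<le> k" "k \<le> j - i" for k
      proof (cases "k = 1")
        case True
        then show ?thesis using short ij by (simp add: q_def)
      next
        case False
        then show ?thesis using jump[of "i - 1 + k"] k ij by (auto simp: q_def)
      qed
      moreover have "1 \<le> j - i" "q (j - i) = q 0" using ij by (auto simp: q_def)
      ultimately have "chain (j - i) q" by (auto simp: chain_def)
      then show False using least[of "j - i" q] ij by linarith
    qed
  qed
  have "closed_segment (A (p (i - 1))) (B (p i)) \<inter> closed_segment (A (p (j - 1))) (B (p j)) = {}"
    if "i \<in> {1..n}" "j \<in> {1..n}" "i \<noteq> j" for i j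
    using disjoint[of i j] disjoint[of j i] that by (cases "i < j") auto
  then show ?thesis using np unfolding chain_def by blast
qed

text \<open>
  Every point is moved by at most one of the local homeomorphisms, so the displacement of their
  composition is bounded by the diameters of the sets \<open>V i\<close>.
\<close>

lemma homeomorphism_moving_points_in_disjoint_sets:
  fixes V :: "'i \<Rightarrow> 'a::euclidean_space set"
  assumes "finite I"
    and V: "\<And>i. i \<in> I \<Longrightarrow> open (V i) \<and> connected (V i) \<and> a i \<in> V i \<and> b i \<in> V i"
    and disj: "\<And>i j. i \<in> I \<Longrightarrow> j \<in> I \<Longrightarrow> i \<noteq> j \<Longrightarrow> V i \<inter> V j = {}"
  shows "\<exists>h k. homeomorphism UNIV UNIV h k \<and> (\<forall>i\<in>I. h (a i) = b i) \<and>
    (\<forall>z. h z = z \<or> (\<exists>i\<in>I. z \<in> V i \<and> h z \<in> V i))"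
  using assms
proof (induction I)
  case empty
  then show ?case by (intro exI[of _ id]) (auto simp: homeomorphism_def)
next
  case (insert j I)
  then obtain h k where hk: "homeomorphism UNIV UNIV h k" "\<And>i. i \<in> I \<Longrightarrow> h (a i) = b i"
    "\<And>z. h z = z \<or> (\<exists>i\<in>I. z \<in> V i \<and> h z \<in> V i)"
    by (metis insertCI)
  have Vj: "open (V j)" "connected (V j)" "a j \<in> V j" "b j \<in> V j" using insert.prems by auto
  then have affine: "affine hull V j = UNIV" by (intro affine_hull_open) auto
  obtain h' k' where h': "homeomorphism UNIV UNIV h' k'" "h' (a j) = b j"
    "{x. \<not> (h' x = x \<and> k' x = x)} \<subseteq> V j"
  proof (rule homeomorphism_moving_point[of "V j" UNIV "a j" "b j"])
    show "openin (top_of_set (affine hull V j)) (V j)"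
      using Vj affine by simp
  qed (use Vj affine in auto)
  have fixed: "h' z = z" if "z \<notin> V j" for z using h'(3) that by blast
  have stays: "h' z \<in> V j" if "z \<in> V j" for z
  proof (rule ccontr)
    assume "h' z \<notin> V j"
    then have "h' (h' z) = h' z" by (rule fixed)
    then have "h' z = z" using h'(1) by (metis UNIV_I homeomorphism_apply1)
    then show False using \<open>h' z \<notin> V j\<close> that by simp
  qed
  have apart: "z \<notin> V j" if "i \<in> I" "z \<in> V i" for i z
    using insert.prems(2)[of i j] insert.hyps that by auto
  have "homeomorphism UNIV UNIV (h' \<circ> h) (k \<circ> k')"
    using homeomorphism_compose[OF hk(1) h'(1)] .
  moreover have "(h' \<circ> h) (a i) = b i" if "i \<in> insert j I" for i
  proof (cases "i = j")
    case True
    have "h (a j) = a j" using hk(3)[of "a j"] apart Vj by blast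
    then show ?thesis using True h'(2) by simp
  next
    case False
    then have "i \<in> I" using that by simp
    then show ?thesis using hk(2) fixed apart insert.prems(1)[of i] by simp
  qed
  moreover have "(h' \<circ> h) z = z \<or> (\<exists>i\<in>insert j I. z \<in> V i \<and> (h' \<circ> h) z \<in> V i)" for z
  proof (cases "h z = z")
    case True
    then show ?thesis using fixed[of z] stays[of z] by auto
  next
    case False
    then obtain i where "i \<in> I" "z \<in> V i" "h z \<in> V i" using hk(3) by blast
    then show ?thesis using fixed apart by auto
  qed
  ultimately show ?case by blast
qed

text \<open>
  The neighbourhoods are those of radius \<open>d\<close>, where \<open>2 * d\<close> is at most the distance between any two
  of the sets; convexity is needed to move points within each of them.
\<close>

lemma disjoint_convex_neighbourhoods:
  fixes S :: "'i \<Rightarrow> 'a::euclidean_space set"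
  assumes "finite I" and S: "\<And>i. i \<in> I \<Longrightarrow> compact (S i) \<and> convex (S i)"
    and disj: "\<And>i j. i \<in> I \<Longrightarrow> j \<in> I \<Longrightarrow> i \<noteq> j \<Longrightarrow> S i \<inter> S j = {}" and "0 < e"
  obtains V where "\<And>i. i \<in> I \<Longrightarrow> open (V i) \<and> convex (V i) \<and> S i \<subseteq> V i"
    "\<And>i z. i \<in> I \<Longrightarrow> z \<in> V i \<Longrightarrow> \<exists>x\<in>S i. dist x z < e"
    "\<And>i j. i \<in> I \<Longrightarrow> j \<in> I \<Longrightarrow> i \<noteq> j \<Longrightarrow> V i \<inter> V j = {}"
proof -
  define P where "P = {(i, j). i \<in> I \<and> j \<in> I \<and> i \<noteq> j}"
  have "finite P" by (rule finite_subset[of _ "I \<times> I"]) (auto simp: P_def \<open>finite I\<close>)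
  have "\<exists>D>0. \<forall>x\<in>S (fst q). \<forall>y\<in>S (snd q). D \<le> dist x y" if "q \<in> P" for q
    using separate_compact_closed[of "S (fst q)" "S (snd q)"] S disj that
    by (auto simp: P_def compact_imp_closed)
  then obtain D where D: "\<And>q. q \<in> P \<Longrightarrow> D q > 0"
    "\<And>q x y. q \<in> P \<Longrightarrow> x \<in> S (fst q) \<Longrightarrow> y \<in> S (snd q) \<Longrightarrow> D q \<le> dist x y"
    by metis
  define d where "d = Min (insert (2 * e) (D ` P)) / 2"
  have d: "0 < d" "d \<le> e" "\<And>q. q \<in> P \<Longrightarrow> 2 * d \<le> D q"
    using \<open>finite P\<close> D(1) \<open>0 < e\<close> by (auto simp: d_def min_def)
  define V where "V = (\<lambda>i. \<Union>x\<in>S i. ball x d)"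
  have near: "\<exists>x\<in>S i. dist x z < d" if "z \<in> V i" for i z
    using that by (simp add: V_def)
  show thesis
  proof (rule that[of V])
    fix i assume i: "i \<in> I"
    have "(\<Union>x\<in>S i. \<Union>y\<in>ball 0 d. {x + y}) = V i"
    proof (intro equalityI subsetI)
      fix z assume "z \<in> V i"
      then obtain x where x: "x \<in> S i" "dist x z < d" using near by blast
      then have "z - x \<in> ball 0 d" "z = x + (z - x)" by (auto simp: dist_norm norm_minus_commute)
      then show "z \<in> (\<Union>x\<in>S i. \<Union>y\<in>ball 0 d. {x + y})" using x(1) by blast
    next
      fix z assume "z \<in> (\<Union>x\<in>S i. \<Union>y\<in>ball 0 d. {x + y})"
      then obtain x y where "x \<in> S i" "y \<in> ball 0 d" "z = x + y" by blast
      then show "z \<in> V i" unfolding V_def by (auto simp: dist_norm intro!: bexI[of _ x])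
    qed
    then have "convex (V i)"
      using convex_sums[of "S i" "ball 0 d"] S[OF i] by simp
    moreover have "open (V i)" unfolding V_def by blast
    moreover have "S i \<subseteq> V i" using d(1) by (auto simp: V_def)
    ultimately show "open (V i) \<and> convex (V i) \<and> S i \<subseteq> V i" by blast
  next
    show "\<exists>x\<in>S i. dist x z < e" if "z \<in> V i" for i z
      using near[OF that] d(2) by (meson less_le_trans)
  next
    fix i j assume ij: "i \<in> I" "j \<in> I" "i \<noteq> j"
    show "V i \<inter> V j = {}"
    proof (rule ccontr)
      assume "V i \<inter> V j \<noteq> {}"
      then obtain z where "z \<in> V i" "z \<in> V j" by blast
      then obtain x y where "x \<in> S i" "y \<in> S j" "dist x z < d" "dist y z < d" using near by blast
      moreover from this have "2 * d \<le> dist x y"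
        using d(3)[of "(i, j)"] D(2)[of "(i, j)" x y] ij by (simp add: P_def)
      ultimately show False using dist_triangle2[of x y z] by linarith
    qed
  qed
qed

text \<open>
  A closed chain would lead to the map \<open>g\<close>, which first applies \<open>f\<close> and then, in the coordinates
  \<open>\<phi>\<close>, a homeomorphism \<open>h\<close> that performs all jumps of a chain with disjoint jumps. The chain is a
  periodic orbit of \<open>g\<close>. As \<open>h\<close> moves points by less than one and \<open>f\<close> by at least one, \<open>g\<close> has no
  fixed point. As \<open>h\<close> is the identity far away, \<open>g\<close> agrees with \<open>f\<close> near some point, where its
  winding number condition is inherited from \<open>f\<close>.
\<close>

lemma no_closed_chain:
  fixes f \<phi> \<psi> :: "complex \<Rightarrow> complex" and q :: "nat \<Rightarrow> complex"
  assumes hom: "homeomorphism UNIV UNIV f f'"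
    and wind: "\<And>a r. 0 < r \<Longrightarrow> winding_number (f \<circ> circlepath a r) (f a) = 1"
    and coord: "homeomorphism UNIV UNIV \<phi> \<psi>" "\<And>x. 1 \<le> dist (\<phi> (f x)) (\<phi> x)"
    and m: "m \<ge> 1" "q m = q 0"
    and chain: "\<And>i. i \<in> {1..m} \<Longrightarrow> dist (\<phi> (f (q (i - 1)))) (\<phi> (q i)) < 1/4"
  shows False
proof -
  have contf: "continuous_on UNIV f" and f'f: "\<And>x. f' (f x) = x" and ff': "\<And>x. f (f' x) = x"
    using hom by (auto simp: homeomorphism_def)
  have cont\<phi>: "continuous_on UNIV \<phi>" and cont\<psi>: "continuous_on UNIV \<psi>"
    and \<psi>\<phi>: "\<And>x. \<psi> (\<phi> x) = x" and \<phi>\<psi>: "\<And>x. \<phi> (\<psi> x) = x"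
    using coord(1) by (auto simp: homeomorphism_def)
  obtain n :: nat and p where n: "n \<ge> 1" "p n = p 0"
    and short: "\<And>i. i \<in> {1..n} \<Longrightarrow> dist (\<phi> (f (p (i - 1)))) (\<phi> (p i)) < 1/4"
    and apart: "\<And>i j. i \<in> {1..n} \<Longrightarrow> j \<in> {1..n} \<Longrightarrow> i \<noteq> j \<Longrightarrow>
       closed_segment (\<phi> (f (p (i - 1)))) (\<phi> (p i)) \<inter> closed_segment (\<phi> (f (p (j - 1)))) (\<phi> (p j)) = {}"
    using closed_chain_with_disjoint_jumps[of m q "\<lambda>x. \<phi> (f x)" \<phi> "1/4"] m chain by metis
  define u where "u = (\<lambda>i. \<phi> (f (p (i - 1))))"
  define v where "v = (\<lambda>i. \<phi> (p i))"
  have uv: "dist (u i) (v i) < 1/4" if "i \<in> {1..n}" for i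
    using short[OF that] by (simp add: u_def v_def)
  obtain V where V: "\<And>i. i \<in> {1..n} \<Longrightarrow> open (V i) \<and> convex (V i) \<and> closed_segment (u i) (v i) \<subseteq> V i"
    and near: "\<And>i z. i \<in> {1..n} \<Longrightarrow> z \<in> V i \<Longrightarrow> \<exists>x\<in>closed_segment (u i) (v i). dist x z < 1/4"
    and disj: "\<And>i j. i \<in> {1..n} \<Longrightarrow> j \<in> {1..n} \<Longrightarrow> i \<noteq> j \<Longrightarrow> V i \<inter> V j = {}"
  proof (rule disjoint_convex_neighbourhoods[of "{1..n}" "\<lambda>i. closed_segment (u i) (v i)" "1/4"])
    show "closed_segment (u i) (v i) \<inter> closed_segment (u j) (v j) = {}"
      if "i \<in> {1..n}" "j \<in> {1..n}" "i \<noteq> j" for i j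
      using apart[OF that] by (simp add: u_def v_def)
  qed auto
  \<comment> \<open>The bound \<open>1/4\<close> on jumps and on the radius of the neighbourhoods keeps each of these inside a
    disc of diameter one, so that \<open>h\<close> moves points by less than one.\<close>
  have V_ball: "V i \<subseteq> ball (u i) (1/2)" if i: "i \<in> {1..n}" for i
  proof
    fix z assume "z \<in> V i"
    then obtain x where x: "x \<in> closed_segment (u i) (v i)" "dist x z < 1/4" using near[OF i] by blast
    have "dist (u i) x \<le> dist (u i) (v i)"
      using segment_bound(1)[OF x(1)] by (simp add: dist_norm norm_minus_commute)
    then show "z \<in> ball (u i) (1/2)"
      using x(2) uv[OF i] dist_triangle[of "u i" z x] by simp
  qed
  have "\<exists>h k. homeomorphism UNIV UNIV h k \<and> (\<forall>i\<in>{1..n}. h (u i) = v i) \<and>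
    (\<forall>z. h z = z \<or> (\<exists>i\<in>{1..n}. z \<in> V i \<and> h z \<in> V i))"
  proof (rule homeomorphism_moving_points_in_disjoint_sets)
    show "open (V i) \<and> connected (V i) \<and> u i \<in> V i \<and> v i \<in> V i" if "i \<in> {1..n}" for i
      using V[OF that] by (auto intro: convex_connected)
  qed (use disj in auto)
  then obtain h k where hk: "homeomorphism UNIV UNIV h k"
    and h_moves: "\<And>i. i \<in> {1..n} \<Longrightarrow> h (u i) = v i"
    and h_stays: "\<And>z. h z = z \<or> (\<exists>i\<in>{1..n}. z \<in> V i \<and> h z \<in> V i)"
    by blast
  have h_near: "dist (h z) z < 1" for z
  proof (cases "h z = z")
    case False
    then obtain i where "i \<in> {1..n}" "z \<in> V i" "h z \<in> V i" using h_stays by blast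
    then have "z \<in> ball (u i) (1/2)" "h z \<in> ball (u i) (1/2)" using V_ball by blast+
    then have "dist (u i) z < 1/2" "dist (u i) (h z) < 1/2" by simp_all
    then show ?thesis using dist_triangle3[of "h z" z "u i"] by linarith
  qed simp
  define g where "g = \<psi> \<circ> h \<circ> \<phi> \<circ> f"
  have conth: "continuous_on UNIV h" and injh: "inj h"
    using hk by (auto simp: homeomorphism_def intro: inj_on_inverseI)
  have contg: "continuous_on UNIV g" unfolding g_def
    by (intro continuous_on_compose contf continuous_on_subset[OF cont\<phi>]
        continuous_on_subset[OF conth] continuous_on_subset[OF cont\<psi>]) auto
  have "inj \<psi>" "inj \<phi>" "inj f" using \<phi>\<psi> \<psi>\<phi> f'f by (metis injI)+
  then have injg: "inj g" unfolding g_def using injh by (intro inj_compose)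
  have fpfg: "g x \<noteq> x" for x
  proof
    assume "g x = x"
    then have "h (\<phi> (f x)) = \<phi> x" using \<phi>\<psi> by (metis comp_apply g_def)
    then show False using h_near[of "\<phi> (f x)"] coord(2)[of x] by (simp add: dist_commute)
  qed
  have "(g ^^ i) (p 0) = p i" if "i \<le> n" for i
    using that
  proof (induction i)
    case (Suc i)
    then have "g (p i) = p (Suc i)"
      using h_moves[of "Suc i"] by (simp add: g_def u_def v_def \<psi>\<phi>)
    then show ?case using Suc by simp
  qed simp
  from this[of n] have periodic: "(g ^^ n) (p 0) = p 0" using n by simp
  have "bounded (\<Union>i\<in>{1..n}. V i)"
    by (intro bounded_UN ballI) (auto intro: bounded_subset[OF bounded_ball V_ball])
  then obtain B where B: "\<And>i z. i \<in> {1..n} \<Longrightarrow> z \<in> V i \<Longrightarrow> norm z \<le> B"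
    unfolding bounded_iff by blast
  have h_far: "h z = z" if "B < norm z" for z
    using h_stays[of z] B that by fastforce
  define a where "a = f' (\<psi> (of_real (\<bar>B\<bar> + 1)))"
  define W where "W = {x. B < norm (\<phi> (f x))}"
  have "open W" unfolding W_def
    by (intro open_Collect_less continuous_intros continuous_on_compose2[OF cont\<phi> contf]) auto
  moreover have "a \<in> W" by (simp add: W_def a_def ff' \<phi>\<psi>)
  ultimately obtain r where r: "0 < r" "cball a r \<subseteq> W" by (meson open_contains_cball)
  have gf: "g x = f x" if "x \<in> cball a r" for x
    using r(2) that by (auto simp: g_def W_def h_far \<psi>\<phi>)
  have "circlepath a r t \<in> cball a r" for t
    using r(1) by (simp add: circlepath dist_norm norm_mult)
  then have "g \<circ> circlepath a r = f \<circ> circlepath a r" using gf by auto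
  then have "winding_number (g \<circ> circlepath a r) (g a) = 1" using wind[OF r(1)] gf[of a] r(1) by simp
  from no_periodic_point[OF contg injg fpfg r(1) this n(1) periodic] show False .
qed

section \<open>From the plane to the complex numbers\<close>

definition complex_to_plane :: "complex \<Rightarrow> real ^ 2" where
  "complex_to_plane z = (\<chi> i. if i = 1 then Re z else Im z)"

lemma plane_complex_inverse [simp]:
  "plane_to_complex (complex_to_plane z) = z" "complex_to_plane (plane_to_complex x) = x"
proof -
  show "plane_to_complex (complex_to_plane z) = z"
    by (simp add: plane_to_complex_def complex_to_plane_def)
  show "complex_to_plane (plane_to_complex x) = x"
    unfolding vec_eq_iff plane_to_complex_def complex_to_plane_def by (simp add: forall_2)
qed

lemma homeomorphism_plane_complex:
  "homeomorphism UNIV UNIV plane_to_complex complex_to_plane"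
proof (rule homeomorphismI)
  have "plane_to_complex = (\<lambda>x. of_real (x $ 1) + \<i> * of_real (x $ 2))"
    by (intro ext) (simp add: plane_to_complex_def complex_eq_iff)
  then show "continuous_on UNIV plane_to_complex"
    by (elim ssubst) (intro continuous_intros)
  have "continuous_on UNIV (\<lambda>z. if i = 1 then Re z else Im z)" for i :: 2
    by (cases "i = 1") (auto intro: continuous_intros)
  then show "continuous_on UNIV complex_to_plane"
    unfolding complex_to_plane_def by (intro continuous_on_vec_lambda)
qed auto

theorem theorem3:
  fixes f :: "real ^ 2 \<Rightarrow> real ^ 2"
  assumes "homeomorphic_map euclidean euclidean f"
    and "orientation_preserving f"
    and "\<exists>p. topologically_chain_recurrent f p"
  shows "\<exists>x. f x = x"
proof (rule ccontr)
  assume no_fix: "\<nexists>x. f x = x"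
  let ?c = plane_to_complex and ?d = complex_to_plane
  obtain f' where "homeomorphic_maps euclidean euclidean f f'"
    using assms(1) homeomorphic_map_maps by blast
  then have f': "homeomorphism UNIV UNIV f f'"
    unfolding homeomorphic_maps_def
    by (intro homeomorphismI) (simp_all add: continuous_map_iff_continuous2)
  define F where "F = ?c \<circ> f \<circ> ?d"
  have hom: "homeomorphism UNIV UNIV F (?c \<circ> f' \<circ> ?d)"
    unfolding F_def
    using homeomorphism_compose[OF homeomorphism_compose[OF homeomorphism_symD[OF homeomorphism_plane_complex] f']
        homeomorphism_plane_complex]
    by (simp add: comp_assoc)
  have fpf: "F z \<noteq> z" for z
  proof
    assume "F z = z"
    then have "f (?d z) = ?d z" by (metis F_def comp_apply plane_complex_inverse(2))
    then show False using no_fix by blast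
  qed
  have wind: "winding_number (F \<circ> circlepath a r) (F a) = 1" if r: "0 < r" for a r
  proof -
    define \<gamma> where "\<gamma> = ?d \<circ> circlepath a r"
    have "path \<gamma>" unfolding \<gamma>_def
      using homeomorphism_plane_complex
      by (intro path_continuous_image) (auto simp: homeomorphism_def intro: continuous_on_subset)
    moreover have "pathfinish \<gamma> = pathstart \<gamma>"
      by (simp add: \<gamma>_def pathfinish_compose pathstart_compose)
    moreover have "?d a \<notin> path_image \<gamma>"
    proof
      assume "?d a \<in> path_image \<gamma>"
      then obtain z where "z \<in> path_image (circlepath a r)" "?d a = ?d z"
        by (auto simp: \<gamma>_def path_image_compose)
      then have "a \<in> path_image (circlepath a r)" by (metis plane_complex_inverse(1))
      then show False using r by simp
    qed
    ultimately have "plane_winding_number (f \<circ> \<gamma>) (f (?d a)) = plane_winding_number \<gamma> (?d a)"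
      using assms(2) by (simp add: orientation_preserving_def)
    moreover have "?c \<circ> \<gamma> = circlepath a r" "?c \<circ> (f \<circ> \<gamma>) = F \<circ> circlepath a r"
      by (auto simp: \<gamma>_def F_def)
    ultimately show ?thesis
      using winding_number_circlepath_centre[OF r] by (simp add: plane_winding_number_def F_def)
  qed
  obtain \<phi> \<psi> :: "complex \<Rightarrow> complex" where \<phi>: "homeomorphism UNIV UNIV \<phi> \<psi>" "\<And>z. 1 \<le> dist (\<phi> (F z)) (\<phi> z)"
    by (rule displacement_at_least_one_coordinates[OF hom fpf]) (rule that)
  define N where "N = {z. dist (\<phi> (?c (fst z))) (\<phi> (?c (snd z))) < 1/4}"
  have "continuous_on UNIV (\<phi> \<circ> ?c)"
    using \<phi>(1) homeomorphism_plane_complex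
    by (intro continuous_on_compose) (auto simp: homeomorphism_def intro: continuous_on_subset)
  then have cont: "continuous_on UNIV (\<lambda>x. \<phi> (?c x))" by (simp add: o_def)
  have "open N" unfolding N_def
    by (intro open_Collect_less continuous_intros continuous_on_compose2[OF cont]) auto
  moreover have "diagonal \<subseteq> N" by (auto simp: diagonal_def N_def)
  ultimately have "diagonal_nbhd N" by (auto simp: diagonal_nbhd_def)
  then obtain x n p where "nbhd_chain_from_to N f n p x x"
    using assms(3) unfolding topologically_chain_recurrent_def by blast
  then have n: "n \<ge> 1" "p n = p 0" and p: "\<And>i. i \<in> {1..n} \<Longrightarrow> (f (p (i - 1)), p i) \<in> N"
    by (auto simp: nbhd_chain_from_to_def nbhd_chain_def)
  show False
  proof (rule no_closed_chain[OF hom wind \<phi> n(1), of "?c \<circ> p"])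
    show "dist (\<phi> (F ((?c \<circ> p) (i - 1)))) (\<phi> ((?c \<circ> p) i)) < 1/4" if "i \<in> {1..n}" for i
      using p[OF that] by (simp add: N_def F_def)
  qed (use n in auto)
qed

end
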